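(* Let $\lambda$ be a nonzero real number, $u\in\mathbb{C}$ with $u\neq1$, and $r$ a nonnegative integer. Let $p(x)\in\mathbb{C}[x]$ with $\deg p(x)=n$, and let $g(t)=\frac{e^t-u}{1-u}$, $f(t)=\frac{1}{\lambda}(e^{\lambda t}-1)$. Then $p(x)=\sum_{k=0}^{n}a_k\,h^{(r)}_{k,\lambda}(x|u)$, where for $k=0,\dots,n$, \begin{align*} a_k&=\frac{1}{k!}g(t)^r f(t)^k p(x)\Big|_{x=0} =\frac{1}{(1-u)^r k!\,\lambda^k}\sum_{j=0}^{r}\binom{r}{j}(-u)^{r-j}\Delta_\lambda^k p(j)\\ &=\frac{1}{(1-u)^r k!\,\lambda^k}\sum_{j=0}^{r}\sum_{l=0}^{k}\binom{r}{j}\binom{k}{l}(-u)^{r-j}(-1)^{k-l}p(l\lambda+j)\\ &=\frac{1}{(1-u)^r\lambda^k}\sum_{j=0}^{r}\sum_{l=k}^{n}\binom{r}{j}(-u)^{r-j}\frac{\lambda^l}{l!}S_2(l,k)\,p^{(l)}(j), \end{align*} and, when $r\ge1$, also \[a_k=\frac{1}{(1-u)^r k!\,\lambda^k}\sum_{j=0}^{r-1}\binom{r-1}{j}(-u)^{r-j-1}\Delta_\lambda^k\big(p(x+j+1)-up(x+j)\big)\Big|_{x=0}.\]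
   Context: The degenerate exponential is $e_\lambda^x(t)=(1+\lambda t)^{x/\lambda}$, $e_\lambda(t)=e_\lambda^1(t)$. The degenerate Frobenius-Euler polynomials of order $r$ are defined by $\big(\frac{1-u}{e_\lambda(t)-u}\big)^r e_\lambda^x(t)=\sum_{n\ge0}h^{(r)}_{n,\lambda}(x|u)\frac{t^n}{n!}$. A formal power series $F(t)$ acts on polynomials as a differential operator via $t^k x^m=(m)_k x^{m-k}$ (i.e. $t=d/dx$, so $e^{yt}q(x)=q(x+y)$). For a polynomial $q$: $\Delta_\lambda^k q(x)=\sum_{i=0}^k\binom{k}{i}(-1)^{k-i}q(x+i\lambda)$, and $\Delta_\lambda^k p(j)$ means $(\Delta_\lambda^k p)(x)$ at $x=j$. $p^{(l)}$ is the $l$-th derivative; $S_2(l,k)$ are Stirling numbers of the second kind, $\frac{1}{k!}(e^t-1)^k=\sum_{l\ge k}S_2(l,k)\frac{t^l}{l!}$. *)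

theory Defs
  imports
    Complex_Main
    "HOL-Computational_Algebra.Computational_Algebra"
    "HOL-Combinatorics.Stirling"
begin

text \<open>
  The formal power series \<open>(1 + \<lambda> t) ^ (x / \<lambda>)\<close> in \<open>t\<close>: the binomial series with exponent
  \<open>x / \<lambda>\<close>, with \<open>\<lambda> t\<close> substituted for its variable. It is meant for \<open>\<lambda> \<noteq> 0\<close>.
\<close>

definition degen_exp :: "real \<Rightarrow> complex \<Rightarrow> complex fps" where
  "degen_exp lam x =
     fps_binomial (x / of_real lam) oo (fps_const (of_real lam) * fps_X)"

text \<open>
  The polynomial with index \<open>n\<close>, as a polynomial function of \<open>x\<close>: \<open>n!\<close> times the coefficient of
  \<open>t ^ n\<close> in the generating function. For \<open>u \<noteq> 1\<close> the denominator has the nonzero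
  constant coefficient \<open>1 - u\<close>, so the quotient is an honest quotient of power series.
\<close>

definition degen_frobenius_euler :: "nat \<Rightarrow> nat \<Rightarrow> real \<Rightarrow> complex \<Rightarrow> complex \<Rightarrow> complex" where
  "degen_frobenius_euler r n lam x u =
     fact n * fps_nth
       ((fps_const (1 - u) / (degen_exp lam 1 - fps_const u)) ^ r * degen_exp lam x) n"

text \<open>
  A power series acting as a differential operator, with \<open>t\<close> acting as \<open>d/dx\<close>. Derivatives of
  order above \<open>degree p\<close> vanish, so the sum may be truncated there.
\<close>

definition fps_diff_op :: "complex fps \<Rightarrow> complex poly \<Rightarrow> complex poly" where
  "fps_diff_op F p = (\<Sum>k\<le>degree p. smult (fps_nth F k) ((pderiv ^^ k) p))"

definition g_series :: "complex \<Rightarrow> complex fps" where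
  "g_series u = (fps_exp 1 - fps_const u) / fps_const (1 - u)"

definition f_series :: "real \<Rightarrow> complex fps" where
  "f_series lam = fps_const (1 / of_real lam) * (fps_exp (of_real lam) - 1)"

definition delta_pow :: "real \<Rightarrow> nat \<Rightarrow> (complex \<Rightarrow> complex) \<Rightarrow> complex \<Rightarrow> complex" where
  "delta_pow lam k q x =
     (\<Sum>i\<le>k. of_nat (k choose i) * (- 1) ^ (k - i) * q (x + of_nat i * of_real lam))"

text \<open>
  The recursively defined \<^const>\<open>Stirling\<close> has the exponential generating
  function \<open>(e ^ t - 1) ^ k / k!\<close>.
\<close>

lemma Stirling_egf:
  "fps_const (1 / fact k) * (fps_exp 1 - 1) ^ k =
     Abs_fps (\<lambda>l. of_nat (Stirling l k) / (fact l :: complex))"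
proof -
  let ?G = "\<lambda>k. (fps_exp 1 - 1 :: complex fps) ^ k"
  have rec: "of_nat (Suc l) * fps_nth (?G (Suc k)) (Suc l) =
      of_nat (Suc k) * (fps_nth (?G (Suc k)) l + fps_nth (?G k) l)" for k l
  proof -
    have "fps_deriv (?G (Suc k)) = of_nat (Suc k) * (?G (Suc k) + ?G k)"
      by (simp only: fps_deriv_power fps_of_nat) (simp add: algebra_simps)
    then have "fps_nth (fps_deriv (?G (Suc k))) l =
        fps_nth (fps_const (of_nat (Suc k)) * (?G (Suc k) + ?G k)) l"
      by (simp only: fps_of_nat)
    then show ?thesis
      by (simp only: fps_deriv_nth fps_mult_left_const_nth fps_add_nth Suc_eq_plus1)
  qed
  have "fact l * fps_nth (?G k) l = fact k * of_nat (Stirling l k)" for k l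
  proof (induction l arbitrary: k)
    case 0
    show ?case by (cases k) (simp_all add: fps_nth_power_0)
  next
    case (Suc l)
    show ?case
    proof (cases k)
      case 0
      then show ?thesis by simp
    next
      case (Suc m)
      have "fact (Suc l) * fps_nth (?G (Suc m)) (Suc l) =
          fact l * (of_nat (Suc l) * fps_nth (?G (Suc m)) (Suc l))"
        by (simp only: fact_Suc of_nat_mult mult_ac)
      also have "\<dots> = of_nat (Suc m) *
          (fact l * fps_nth (?G (Suc m)) l + fact l * fps_nth (?G m) l)"
        by (simp only: rec distrib_left mult_ac)
      also have "\<dots> = fact (Suc m) * of_nat (Stirling (Suc l) (Suc m))"
        by (simp only: Suc.IH) (simp add: algebra_simps)
      finally show ?thesis using Suc by simp
    qed
  qed
  then show ?thesis
    by (simp add: fps_eq_iff divide_simps mult.commute)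
qed

end

theory Submission
  imports Defs
begin

text \<open>
  Since \<open>e\<^sub>\<lambda>\<^sup>x(f(t)) = e\<^sup>x\<^sup>t\<close>, substituting \<open>f(t)\<close> into the generating function gives
  \<open>\<Sum>\<^sub>k h\<^sub>k(x) f(t)\<^sup>k / k! = g(t)\<^sup>-\<^sup>r e\<^sup>x\<^sup>t\<close>. Multiply by \<open>g(t)\<^sup>r\<close> and apply to \<open>p\<close> at \<open>0\<close>: the right-hand
  side becomes \<open>p(x)\<close>, and on the left only \<open>k \<le> deg p\<close> survives because \<open>f\<close> has order one.
  The closed forms of \<open>a\<^sub>k\<close> come from expanding \<open>g\<^sup>r f\<^sup>k\<close> into exponentials \<open>e\<^sup>y\<^sup>t\<close>, which act as
  evaluation at \<open>y\<close>.
\<close>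

section \<open>The pairing of power series with polynomials\<close>

definition diff_eval :: "complex fps \<Rightarrow> complex poly \<Rightarrow> complex" where
  "diff_eval F p = poly (fps_diff_op F p) 0"

text \<open>The \<open>m\<close>-th derivative of \<open>p\<close> at \<open>0\<close> is
  \<open>fact m * coeff p m\<close>. The free bound \<open>N\<close> allows polynomials of different
  degrees to be compared over a common range.\<close>

lemma diff_eval_altdef:
  assumes "degree p \<le> N"
  shows "diff_eval F p = (\<Sum>m\<le>N. fps_nth F m * fact m * coeff p m)"
proof -
  have "diff_eval F p = (\<Sum>m\<le>degree p. fps_nth F m * fact m * coeff p m)"
    by (simp add: diff_eval_def fps_diff_op_def poly_0_coeff_0 coeff_sum coeff_higher_pderiv
        pochhammer_fact mult.assoc)
  also have "\<dots> = (\<Sum>m\<le>N. fps_nth F m * fact m * coeff p m)"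
    by (rule sum.mono_neutral_left) (use assms in \<open>auto simp: coeff_eq_0\<close>)
  finally show ?thesis .
qed

text \<open>Only finitely many coefficients of the series matter; this is what justifies truncating
  infinite expansions.\<close>

lemma diff_eval_cong:
  assumes "\<And>m. m \<le> degree p \<Longrightarrow> fps_nth F m = fps_nth G m"
  shows "diff_eval F p = diff_eval G p"
  using assms by (simp add: diff_eval_altdef[OF order.refl])

lemma diff_eval_add: "diff_eval (F + G) p = diff_eval F p + diff_eval G p"
  by (simp add: diff_eval_altdef[OF order.refl] algebra_simps sum.distrib)

lemma diff_eval_const_mult: "diff_eval (fps_const c * F) p = c * diff_eval F p"
  by (simp add: diff_eval_altdef[OF order.refl] sum_distrib_left mult.assoc)

lemma diff_eval_diff: "diff_eval (F - G) p = diff_eval F p - diff_eval G p"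
  by (simp add: diff_eval_altdef[OF order.refl] algebra_simps sum_subtractf)

lemma diff_eval_sum: "diff_eval (\<Sum>i\<in>A. F i) p = (\<Sum>i\<in>A. diff_eval (F i) p)"
  by (induction A rule: infinite_finite_induct)
     (simp_all add: diff_eval_add, simp_all add: diff_eval_altdef[OF order.refl])

lemma diff_eval_exp: "diff_eval (fps_exp y) p = poly p y"
  by (simp add: diff_eval_altdef[OF order.refl] poly_altdef mult.commute)

text \<open>Multiplication by \<open>fps_X\<close> is adjoint to differentiation.\<close>

lemma diff_eval_mult_X: "diff_eval (F * fps_X) p = diff_eval F (pderiv p)"
proof -
  \<comment> \<open>The range gets one extra index: the term at \<open>0\<close> vanishes, and
    shifting the others down leaves exactly \<open>m \<le> degree p\<close>.\<close>
  have "diff_eval (F * fps_X) p =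
      (\<Sum>m\<le>Suc (degree p). fps_nth (F * fps_X) m * fact m * coeff p m)"
    by (rule diff_eval_altdef) simp
  also have "\<dots> = (\<Sum>m\<le>degree p. fps_nth F m * fact m * coeff (pderiv p) m)"
    by (subst sum.atMost_Suc_shift) (simp add: coeff_pderiv algebra_simps)
  also have "\<dots> = diff_eval F (pderiv p)"
    by (rule diff_eval_altdef[symmetric]) (simp add: degree_pderiv)
  finally show ?thesis .
qed

lemma diff_eval_mult_X_power: "diff_eval (F * fps_X ^ l) p = diff_eval F ((pderiv ^^ l) p)"
proof (induction l arbitrary: p)
  case (Suc l)
  have "diff_eval (F * fps_X ^ Suc l) p = diff_eval ((F * fps_X ^ l) * fps_X) p"
    by (simp add: mult_ac)
  then show ?case
    by (simp only: diff_eval_mult_X Suc.IH funpow_Suc_right o_apply)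
qed simp

text \<open>By adjointness each power of \<open>fps_X\<close> in \<open>H\<close> becomes a
  derivative, and \<open>fps_exp y\<close> then evaluates at \<open>y\<close>. Powers above
  \<open>n\<close> cannot affect coefficients up to \<open>degree p\<close>.\<close>

lemma diff_eval_exp_mult:
  assumes "degree p \<le> n"
  shows "diff_eval (fps_exp y * H) p = (\<Sum>l\<le>n. fps_nth H l * poly ((pderiv ^^ l) p) y)"
proof -
  have "diff_eval (fps_exp y * H) p =
      diff_eval (\<Sum>l\<le>n. fps_const (fps_nth H l) * (fps_exp y * fps_X ^ l)) p"
  proof (rule diff_eval_cong)
    fix m assume "m \<le> degree p"
    then have "m \<le> n" using assms by simp
    have "(\<Sum>l\<le>n. fps_nth H l * fps_nth (fps_exp y * fps_X ^ l) m) =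
        (\<Sum>l\<le>m. fps_nth H l * fps_nth (fps_exp y) (m - l))"
      using \<open>m \<le> n\<close> by (intro sum.mono_neutral_cong_right) (auto simp: fps_X_power_mult_right_nth)
    also have "\<dots> = fps_nth (H * fps_exp y) m"
      by (simp add: fps_mult_nth atMost_atLeast0)
    finally show "fps_nth (fps_exp y * H) m =
        fps_nth (\<Sum>l\<le>n. fps_const (fps_nth H l) * (fps_exp y * fps_X ^ l)) m"
      by (simp add: fps_sum_nth mult.commute)
  qed
  then show ?thesis
    by (simp add: diff_eval_sum diff_eval_const_mult diff_eval_mult_X_power diff_eval_exp)
qed

section \<open>Substitution of \<open>f_series\<close> into the generating function\<close>

lemma fps_binomial_compose_exp:
  "fps_binomial c oo (fps_exp b - 1) = fps_exp (c * b :: 'a :: field_char_0)"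
proof -
  let ?B = "fps_binomial c oo (fps_exp b - 1)"
  \<comment> \<open>The derivative of \<open>fps_binomial c\<close> is a quotient by
    \<open>1 + fps_X\<close>; a unit denominator can be cleared.\<close>
  have unit: "(1 + fps_X :: 'a fps) dvd 1"
    by (simp add: fps_is_unit_iff)
  have "(1 + fps_X) * fps_deriv (fps_binomial c) = fps_const c * fps_binomial c"
    using unit by (simp add: fps_binomial_deriv unit_imp_dvd)
  then have "((1 + fps_X) * fps_deriv (fps_binomial c)) oo (fps_exp b - 1) =
      (fps_const c * fps_binomial c) oo (fps_exp b - 1)"
    by simp
  then have ode: "fps_exp b * (fps_deriv (fps_binomial c) oo (fps_exp b - 1)) = fps_const c * ?B"
    by (simp add: fps_compose_mult_distrib fps_compose_add_distrib)
  \<comment> \<open>The chain rule and \<open>ode\<close> show that \<open>?B\<close> solves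
    \<open>y' = c b y\<close>, which determines it up to its constant coefficient, here
    \<open>1\<close>.\<close>
  have "fps_deriv ?B = fps_const b *
      (fps_exp b * (fps_deriv (fps_binomial c) oo (fps_exp b - 1)))"
    by (simp add: fps_compose_deriv mult_ac)
  also have "\<dots> = fps_const (c * b) * ?B"
    by (simp only: ode mult.assoc[symmetric] fps_const_mult) (simp add: mult.commute)
  finally have "?B = fps_const (fps_nth ?B 0) * fps_exp (c * b)"
    by (simp only: fps_exp_unique_ODE)
  then show ?thesis by simp
qed

lemma f_series_nth_0 [simp]: "fps_nth (f_series lam) 0 = 0"
  by (simp add: f_series_def)

text \<open>The inner argument \<open>lam * t\<close> becomes \<open>fps_exp lam - 1\<close> at
  \<open>f_series lam\<close>, so the exponents \<open>x / lam\<close> and \<open>lam\<close>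
  multiply to \<open>x\<close>.\<close>

lemma degen_exp_compose_f_series:
  assumes "lam \<noteq> 0"
  shows "degen_exp lam x oo f_series lam = fps_exp x"
proof -
  have "fps_const (complex_of_real lam) * f_series lam = fps_exp (of_real lam) - 1"
    using assms by (simp add: f_series_def mult.assoc[symmetric])
  then have "(fps_const (of_real lam) * fps_X) oo f_series lam = fps_exp (of_real lam) - 1"
    by (simp add: fps_compose_mult_distrib)
  then have "degen_exp lam x oo f_series lam =
      fps_binomial (x / of_real lam) oo (fps_exp (of_real lam) - 1)"
    unfolding degen_exp_def by (subst fps_compose_assoc[symmetric]) simp_all
  then show ?thesis
    using assms by (simp add: fps_binomial_compose_exp)
qed

lemma g_series_altdef:
  assumes "u \<noteq> 1"
  shows "g_series u = fps_const (1 / (1 - u)) * (fps_exp 1 - fps_const u)"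
  using assms by (simp add: g_series_def fps_divide_unit fps_const_inverse mult.commute inverse_eq_divide)

lemma degen_frobenius_euler_kernel_compose:
  assumes "lam \<noteq> 0" "u \<noteq> 1"
  shows "g_series u ^ r *
    (((fps_const (1 - u) / (degen_exp lam 1 - fps_const u)) ^ r * degen_exp lam x) oo f_series lam)
    = fps_exp x"
proof -
  define D where "D = degen_exp lam 1 - fps_const u"
  define Q where "Q = fps_const (1 - u) / D"
  \<comment> \<open>A nonzero constant coefficient makes \<open>D\<close> invertible, so
    \<open>Q\<close> is a true quotient. As \<open>D\<close> composes to
    \<open>fps_exp 1 - fps_const u\<close>, the composite of \<open>Q\<close> is inverse to
    \<open>g_series u\<close>.\<close>
  have "fps_nth D 0 = 1 - u"
    by (simp add: D_def degen_exp_def)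
  then have "Q * D = fps_const (1 - u)"
    using assms by (simp add: Q_def fps_divide_unit mult.assoc inverse_mult_eq_1)
  then have "(Q oo f_series lam) * (D oo f_series lam) = fps_const (1 - u)"
    by (metis fps_compose_mult_distrib fps_const_compose f_series_nth_0)
  then have "fps_const (1 / (1 - u)) * ((Q oo f_series lam) * (fps_exp 1 - fps_const u)) = 1"
    using assms
    by (simp add: D_def fps_compose_sub_distrib degen_exp_compose_f_series)
  then have "g_series u * (Q oo f_series lam) = 1"
    using assms by (simp add: g_series_altdef mult_ac)
  then have "g_series u ^ r * (Q ^ r oo f_series lam) = 1"
    by (simp add: fps_compose_power[symmetric] power_mult_distrib[symmetric])
  then have "g_series u ^ r * ((Q ^ r * degen_exp lam x) oo f_series lam) = fps_exp x"
    using assms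
    by (simp add: fps_compose_mult_distrib degen_exp_compose_f_series mult.assoc[symmetric])
  then show ?thesis
    by (simp only: Q_def D_def)
qed

section \<open>Expansion of the polynomial\<close>

lemma fps_mult_compose_nth:
  fixes f :: "'a::idom fps"
  assumes "fps_nth f 0 = 0" "m \<le> n"
  shows "fps_nth (F * (G oo f)) m = fps_nth (\<Sum>k\<le>n. fps_const (fps_nth G k) * (F * f ^ k)) m"
proof -
  \<comment> \<open>With zero constant coefficient, \<open>f ^ k\<close> has no terms below degree
    \<open>k\<close>, so the terms between \<open>i\<close> and \<open>n\<close> contribute
    nothing.\<close>
  have trunc: "fps_nth (G oo f) i = fps_nth (\<Sum>k\<le>n. fps_const (fps_nth G k) * f ^ k) i" if "i \<le> m" for i
    unfolding fps_compose_nth fps_sum_nth fps_mult_left_const_nth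
    using that assms by (intro sum.mono_neutral_left) (auto intro: startsby_zero_power_prefix[rule_format])
  have "fps_nth (F * (G oo f)) m = fps_nth (F * (\<Sum>k\<le>n. fps_const (fps_nth G k) * f ^ k)) m"
    unfolding fps_mult_nth by (intro sum.cong refl) (simp add: trunc)
  also have "F * (\<Sum>k\<le>n. fps_const (fps_nth G k) * f ^ k) =
      (\<Sum>k\<le>n. fps_const (fps_nth G k) * (F * f ^ k))"
    by (simp add: sum_distrib_left mult_ac)
  finally show ?thesis .
qed

lemma poly_eq_sum_degen_frobenius_euler:
  assumes "lam \<noteq> 0" "u \<noteq> 1" "degree p = n"
  shows "poly p x = (\<Sum>k\<le>n. 1 / fact k * diff_eval (g_series u ^ r * f_series lam ^ k) p *
    degen_frobenius_euler r k lam x u)"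
proof -
  define G where
    "G = (fps_const (1 - u) / (degen_exp lam 1 - fps_const u)) ^ r * degen_exp lam x"
  have "poly p x = diff_eval (g_series u ^ r * (G oo f_series lam)) p"
    using assms by (simp add: G_def degen_frobenius_euler_kernel_compose diff_eval_exp)
  also have "\<dots> =
      diff_eval (\<Sum>k\<le>n. fps_const (fps_nth G k) * (g_series u ^ r * f_series lam ^ k)) p"
    using assms by (intro diff_eval_cong fps_mult_compose_nth) auto
  also have "\<dots> = (\<Sum>k\<le>n. fps_nth G k * diff_eval (g_series u ^ r * f_series lam ^ k) p)"
    by (simp add: diff_eval_sum diff_eval_const_mult)
  also have "\<dots> = (\<Sum>k\<le>n. 1 / fact k * diff_eval (g_series u ^ r * f_series lam ^ k) p *
      degen_frobenius_euler r k lam x u)"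
    by (simp add: degen_frobenius_euler_def G_def mult_ac)
  finally show ?thesis .
qed

section \<open>Closed forms of the coefficients\<close>

lemma fps_exp_minus_const_power:
  "(fps_exp c - fps_const v) ^ k =
    (\<Sum>i\<le>k. fps_const (of_nat (k choose i) * (- v) ^ (k - i)) * fps_exp (of_nat i * c :: 'a :: field_char_0))"
proof -
  have "(fps_exp c + fps_const (- v)) ^ k =
      (\<Sum>i\<le>k. of_nat (k choose i) * fps_exp c ^ i * fps_const (- v) ^ (k - i))"
    by (rule binomial_ring)
  also have "\<dots> =
    (\<Sum>i\<le>k. fps_const (of_nat (k choose i) * (- v) ^ (k - i)) * fps_exp (of_nat i * c))"
    unfolding fps_const_power fps_exp_power_mult fps_of_nat[symmetric] fps_const_mult[symmetric]
    by (intro sum.cong refl) (simp only: mult_ac)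
  finally show ?thesis
    by (simp add: fps_const_neg[symmetric] del: fps_const_neg)
qed

text \<open>Exponentials act as translations, so \<open>fps_exp lam - 1\<close> is the forward
  difference with step \<open>lam\<close>.\<close>

lemma diff_eval_delta_pow:
  "diff_eval (fps_exp x * (fps_exp (of_real lam) - 1) ^ k) p = delta_pow lam k (poly p) x"
proof -
  have "fps_exp x * (fps_exp (complex_of_real lam) - 1) ^ k =
      (\<Sum>i\<le>k. fps_const (of_nat (k choose i) * (- 1) ^ (k - i)) *
        fps_exp (x + of_nat i * of_real lam))"
    using fps_exp_minus_const_power[of "complex_of_real lam" 1 k]
    by (simp add: sum_distrib_left fps_exp_add_mult mult_ac)
  then show ?thesis
    by (simp add: diff_eval_sum diff_eval_const_mult diff_eval_exp delta_pow_def)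
qed

lemma diff_eval_coefficient:
  assumes "u \<noteq> 1"
  shows "diff_eval (g_series u ^ r * f_series lam ^ k) p = 1 / ((1 - u) ^ r * of_real lam ^ k) *
    diff_eval ((fps_exp 1 - fps_const u) ^ r * (fps_exp (of_real lam) - 1) ^ k) p"
proof -
  have "g_series u ^ r * f_series lam ^ k = fps_const (1 / ((1 - u) ^ r * of_real lam ^ k)) *
      ((fps_exp 1 - fps_const u) ^ r * (fps_exp (of_real lam) - 1) ^ k)"
    using assms unfolding g_series_altdef[OF assms] f_series_def
    by (simp add: power_mult_distrib fps_const_power power_one_over mult_ac
        flip: fps_const_mult)
  then show ?thesis
    by (simp only: diff_eval_const_mult)
qed

text \<open>The factor \<open>H\<close> is kept general: it is a power of
  \<open>fps_exp lam - 1\<close> in most formulas, and carries one more factor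
  \<open>fps_exp 1 - fps_const u\<close> in the last.\<close>

lemma diff_eval_exp_minus_const_power_mult:
  "diff_eval ((fps_exp 1 - fps_const u) ^ r * H) p =
    (\<Sum>j\<le>r. of_nat (r choose j) * (- u) ^ (r - j) * diff_eval (fps_exp (of_nat j) * H) p)"
  by (simp add: fps_exp_minus_const_power sum_distrib_right mult.assoc diff_eval_sum
      diff_eval_const_mult)

text \<open>This is the Stirling generating function with \<open>t\<close> rescaled to
  \<open>lam * t\<close>.\<close>

lemma fps_exp_minus_1_power_nth:
  "fps_nth ((fps_exp (of_real lam) - 1) ^ k) l =
    fact k * of_real lam ^ l * of_nat (Stirling l k) / (fact l :: complex)"
proof -
  have "(fps_exp 1 - 1 :: complex fps) ^ k =
      fps_const (fact k) * (fps_const (1 / fact k) * (fps_exp 1 - 1) ^ k)"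
    by (simp add: mult.assoc[symmetric])
  then have "(fps_exp 1 - 1 :: complex fps) ^ k =
      fps_const (fact k) * Abs_fps (\<lambda>l. of_nat (Stirling l k) / fact l)"
    by (simp only: Stirling_egf)
  then have "fps_nth ((fps_exp 1 - 1 :: complex fps) ^ k) l =
      fact k * of_nat (Stirling l k) / fact l"
    by simp
  moreover have "(fps_exp (complex_of_real lam) - 1) ^ k =
      (fps_exp 1 - 1) ^ k oo (fps_const (of_real lam) * fps_X)"
    by (simp add: fps_compose_power[symmetric] fps_compose_sub_distrib)
  ultimately show ?thesis
    by (simp add: fps_compose_linear)
qed

theorem theorem4p1:
  fixes lam :: real and u :: complex and r n :: nat and p :: "complex poly"
  assumes "lam \<noteq> 0" and "u \<noteq> 1" and "degree p = n"
  shows "\<exists>a :: nat \<Rightarrow> complex.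
    (\<forall>x. poly p x = (\<Sum>k\<le>n. a k * degen_frobenius_euler r k lam x u)) \<and>
    (\<forall>k\<le>n.
      a k = 1 / fact k * poly (fps_diff_op (g_series u ^ r * f_series lam ^ k) p) 0 \<and>
      a k = 1 / ((1 - u) ^ r * fact k * of_real lam ^ k) *
        (\<Sum>j\<le>r. of_nat (r choose j) * (- u) ^ (r - j) * delta_pow lam k (poly p) (of_nat j)) \<and>
      a k = 1 / ((1 - u) ^ r * fact k * of_real lam ^ k) *
        (\<Sum>j\<le>r. \<Sum>l\<le>k. of_nat (r choose j) * of_nat (k choose l) * (- u) ^ (r - j) *
          (- 1) ^ (k - l) * poly p (of_nat l * of_real lam + of_nat j)) \<and>
      a k = 1 / ((1 - u) ^ r * of_real lam ^ k) *
        (\<Sum>j\<le>r. \<Sum>l=k..n. of_nat (r choose j) * (- u) ^ (r - j) *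
          (of_real lam ^ l / fact l) * of_nat (Stirling l k) *
          poly ((pderiv ^^ l) p) (of_nat j)) \<and>
      (r \<ge> 1 \<longrightarrow>
        a k = 1 / ((1 - u) ^ r * fact k * of_real lam ^ k) *
          (\<Sum>j\<le>r - 1. of_nat ((r - 1) choose j) * (- u) ^ (r - j - 1) *
            delta_pow lam k
              (\<lambda>x. poly p (x + of_nat j + 1) - u * poly p (x + of_nat j)) 0)))"
proof -
  \<comment> \<open>\<open>E\<close> and \<open>W\<close> are \<open>lam * f\<close> and
    \<open>(1 - u) * g\<close>; \<open>c k\<close> collects the scalars thus removed, together with
    \<open>1 / fact k\<close>.\<close>
  define E where "E = fps_exp (complex_of_real lam) - 1"
  define W where "W = fps_exp 1 - fps_const u"
  define c where "c = (\<lambda>k. 1 / ((1 - u) ^ r * fact k * of_real lam ^ k))"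
  define a where "a = (\<lambda>k. 1 / fact k * diff_eval (g_series u ^ r * f_series lam ^ k) p)"
  have a_eq: "a k = c k * diff_eval (W ^ r * E ^ k) p" for k
    using assms(2) by (simp add: a_def c_def W_def E_def diff_eval_coefficient)
  have expansion: "poly p x = (\<Sum>k\<le>n. a k * degen_frobenius_euler r k lam x u)" for x
    unfolding a_def using assms by (rule poly_eq_sum_degen_frobenius_euler)
  have a_delta: "a k = c k *
      (\<Sum>j\<le>r. of_nat (r choose j) * (- u) ^ (r - j) * delta_pow lam k (poly p) (of_nat j))" for k
    by (simp add: a_eq W_def E_def diff_eval_exp_minus_const_power_mult diff_eval_delta_pow)
  have a_values: "a k = c k *
      (\<Sum>j\<le>r. \<Sum>l\<le>k. of_nat (r choose j) * of_nat (k choose l) * (- u) ^ (r - j) *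
        (- 1) ^ (k - l) * poly p (of_nat l * of_real lam + of_nat j))" for k
    by (simp add: a_delta delta_pow_def sum_distrib_left mult_ac add.commute)
  have a_Stirling: "a k = 1 / ((1 - u) ^ r * of_real lam ^ k) *
      (\<Sum>j\<le>r. \<Sum>l=k..n. of_nat (r choose j) * (- u) ^ (r - j) *
        (of_real lam ^ l / fact l) * of_nat (Stirling l k) *
        poly ((pderiv ^^ l) p) (of_nat j))" for k
  proof -
    have "diff_eval (fps_exp (of_nat j) * E ^ k) p = fact k *
        (\<Sum>l=k..n. of_real lam ^ l / fact l * of_nat (Stirling l k) *
          poly ((pderiv ^^ l) p) (of_nat j))" for j
    proof -
      have "diff_eval (fps_exp (of_nat j) * E ^ k) p =
          (\<Sum>l\<le>n. fps_nth (E ^ k) l * poly ((pderiv ^^ l) p) (of_nat j))"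
        using assms(3) by (intro diff_eval_exp_mult) simp
      also have "\<dots> = (\<Sum>l=k..n. fps_nth (E ^ k) l * poly ((pderiv ^^ l) p) (of_nat j))"
        \<comment> \<open>\<open>Stirling l k\<close> vanishes for \<open>l < k\<close>.\<close>
        by (intro sum.mono_neutral_right) (auto simp: E_def fps_exp_minus_1_power_nth)
      finally show ?thesis
        by (simp add: E_def fps_exp_minus_1_power_nth sum_distrib_left mult_ac)
    qed
    then have "a k = c k * (\<Sum>j\<le>r. of_nat (r choose j) * (- u) ^ (r - j) * (fact k *
        (\<Sum>l=k..n. of_real lam ^ l / fact l * of_nat (Stirling l k) *
          poly ((pderiv ^^ l) p) (of_nat j))))"
      unfolding a_eq W_def diff_eval_exp_minus_const_power_mult by simp
    then show ?thesis
      by (simp add: c_def sum_distrib_left mult_ac)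
  qed
  have a_step: "a k = c k *
      (\<Sum>j\<le>r - 1. of_nat ((r - 1) choose j) * (- u) ^ (r - j - 1) *
        delta_pow lam k (\<lambda>x. poly p (x + of_nat j + 1) - u * poly p (x + of_nat j)) 0)"
    if "r \<ge> 1" for k
  proof -
    \<comment> \<open>One factor \<open>W\<close> is left unexpanded: it acts as
      \<open>q(x + 1) - u q(x)\<close>, and the binomial expansion is applied to the remaining
      \<open>W ^ (r - 1)\<close>.\<close>
    have "diff_eval (fps_exp (of_nat j) * (W * E ^ k)) p =
        delta_pow lam k (\<lambda>x. poly p (x + of_nat j + 1) - u * poly p (x + of_nat j)) 0" for j
    proof -
      have "fps_exp (of_nat j) * (W * E ^ k) = fps_exp (of_nat j + 1) * E ^ k -
          fps_const u * (fps_exp (of_nat j) * E ^ k)"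
        by (simp add: W_def fps_exp_add_mult algebra_simps)
      then have "diff_eval (fps_exp (of_nat j) * (W * E ^ k)) p =
          delta_pow lam k (poly p) (of_nat j + 1) - u * delta_pow lam k (poly p) (of_nat j)"
        by (simp only: diff_eval_diff diff_eval_const_mult E_def diff_eval_delta_pow)
      then show ?thesis
        by (simp add: delta_pow_def sum_distrib_left sum_subtractf right_diff_distrib mult_ac
            add_ac)
    qed
    moreover have "W ^ r * E ^ k = W ^ (r - 1) * (W * E ^ k)"
      using that by (cases r) (simp_all add: mult_ac)
    moreover have "diff_eval (W ^ (r - 1) * (W * E ^ k)) p =
        (\<Sum>j\<le>r - 1. of_nat ((r - 1) choose j) * (- u) ^ (r - 1 - j) *
          diff_eval (fps_exp (of_nat j) * (W * E ^ k)) p)"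
      unfolding W_def by (rule diff_eval_exp_minus_const_power_mult)
    ultimately show ?thesis
      by (simp only: a_eq diff_commute[of r _ 1])
  qed
  have a_op: "a k = 1 / fact k * poly (fps_diff_op (g_series u ^ r * f_series lam ^ k) p) 0" for k
    by (simp only: a_def diff_eval_def)
  show ?thesis
    by (rule exI[of _ a], intro conjI allI impI)
       (rule expansion a_op a_delta[unfolded c_def] a_values[unfolded c_def] a_Stirling
        a_step[unfolded c_def], assumption?)+
qed

end
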